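(* Let $m$ be an odd positive integer, $q=2^m$, and let $k\in\{1,2,\ldots,m-1\}$ satisfy $\gcd(k,m)=1$. Put $\sigma=2^k$. Then for every $b\in\mathbf{T}_0^*$, $$\sum_{c\in \mathbf{T}_0^*} p^b_{c,c^\sigma}=q+1,$$ where $p^{c}_{a,b}$ denotes the intersection numbers of the elliptic scheme defined in the context.
   Context: Let $q=2^m$ and let $\mathrm{Tr}:\mathbb{F}_q\to\mathbb{F}_2$ be the absolute trace. For $e\in\mathbb{F}_2$ let $\mathbf{T}_e=\{x\in\mathbb{F}_q:\mathrm{Tr}(x)=e\}$ and $\mathbf{T}_e^*=\mathbf{T}_e\setminus\{0\}$. In $\mathrm{PG}(2,q)$ consider the nonsingular conic $\mathcal{O}=\{(\xi,\xi^2,1):\xi\in\mathbb{F}_q\}\cup\{(0,1,0)\}$. A line is exterior if it meets $\mathcal{O}$ in no point; the exterior lines are exactly the lines $(1,x,y)^\perp=\{(a_0,a_1,a_2): a_0+a_1x+a_2y=0\}$ with $x,y\in\mathbb{F}_q$ and $\mathrm{Tr}(xy)=1$. Let $\mathcal{E}$ be the set of exterior lines. For $\ell=(1,x,y)^\perp$ and $n=(1,z,u)^\perp$ in $\mathcal{E}$ define $\hat\rho(\ell,n)=x^2u^2+y^2z^2+(x+z)(y+u)$. For $a\in\mathbf{T}_0^*$ let $\Gamma_a=\{(\ell,n)\in\mathcal{E}\times\mathcal{E}:\hat\rho(\ell,n)=a\}$, and let $\Gamma_0$ be the diagonal of $\mathcal{E}\times\mathcal{E}$. These $\Gamma_0$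 and $\Gamma_a$ ($a\in\mathbf{T}_0^*$) are precisely the orbitals of the natural action of $\mathrm{PGL}(2,q)$ (the stabilizer of $\mathcal{O}$ in $\mathrm{PGL}(3,q)$) on $\mathcal{E}$, and they form a symmetric association scheme (the elliptic scheme). For $a,b,c\in\mathbf{T}_0^*$, the intersection number $p^c_{a,b}$ is $|\{j\in\mathcal{E}:(\ell,j)\in\Gamma_a,\ (j,n)\in\Gamma_b\}|$ for any $(\ell,n)\in\Gamma_c$ (independent of the choice of $(\ell,n)$). *)

theory Defs
  imports "HOL-Analysis.Analysis"
begin

(* The absolute trace of a field with 2^m elements; its values lie in the prime
   subfield {0, 1}, which plays the role of F_2. *)
definition abs_trace :: "nat \<Rightarrow> 'a::{field,finite} \<Rightarrow> 'a" where
  "abs_trace m x = (\<Sum>i<m. x ^ (2 ^ i))"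

definition trace_fiber :: "nat \<Rightarrow> 'a::{field,finite} \<Rightarrow> 'a set" where
  "trace_fiber m e = {x. abs_trace m x = e}"

(* PG(2,q): points and lines are the subspaces of dimension 1 and 2 of the
   coordinate space, and incidence is inclusion. *)
definition pg_lines :: "('a::{field,finite} ^ 3) set set" where
  "pg_lines = {L. vec.subspace L \<and> vec.dim L = 2}"

definition conic :: "('a::{field,finite} ^ 3) set set" where
  "conic = {vec.span {vector [\<xi>, \<xi> ^ 2, 1]} | \<xi>. True} \<union> {vec.span {vector [0, 1, 0]}}"

definition exterior_lines :: "('a::{field,finite} ^ 3) set set" where
  "exterior_lines = {L \<in> pg_lines. \<not> (\<exists>P \<in> conic. P \<subseteq> L)}"

definition perp :: "'a::{field,finite} ^ 3 \<Rightarrow> ('a ^ 3) set" where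
  "perp v = {a. (\<Sum>i\<in>UNIV. a $ i * v $ i) = 0}"

(* Every exterior line is perp (vector [1, x, y]) for exactly one pair (x, y), so
   the description below determines the value on pairs of exterior lines. *)
definition rho_hat :: "('a::{field,finite} ^ 3) set \<Rightarrow> ('a ^ 3) set \<Rightarrow> 'a" where
  "rho_hat l n = (THE r. \<exists>x y z u. l = perp (vector [1, x, y]) \<and> n = perp (vector [1, z, u]) \<and>
     r = x ^ 2 * u ^ 2 + y ^ 2 * z ^ 2 + (x + z) * (y + u))"

definition elliptic_rel :: "'a::{field,finite} \<Rightarrow> (('a ^ 3) set \<times> ('a ^ 3) set) set" where
  "elliptic_rel a =
     (if a = 0 then Id_on exterior_lines
      else {(l, n) \<in> exterior_lines \<times> exterior_lines. rho_hat l n = a})"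

(* intersection_number a b c is p^c_{a,b}. The count does not depend on the pair
   (l, n) in relation c, and the_elem picks out its common value; it is unspecified
   if relation c is empty or the count is not constant on it. *)
definition intersection_number :: "'a::{field,finite} \<Rightarrow> 'a \<Rightarrow> 'a \<Rightarrow> nat" where
  "intersection_number a b c = the_elem
     ((\<lambda>(l, n). card {j \<in> exterior_lines. (l, j) \<in> elliptic_rel a \<and> (j, n) \<in> elliptic_rel b})
        ` elliptic_rel c)"

end

theory Submission
  imports Defs
begin

text \<open>
  The proof works with an arbitrary symmetric association scheme of constant valency \<open>k\<close> which is
  pseudocyclic (\<open>\<Sum>\<^sub>c p\<^sup>b\<^sub>c\<^sub>,\<^sub>c = k - 1\<close>) and has an automorphism \<open>\<phi>\<close> of the colours, induced by a
  permutation of the vertices, that fixes only the diagonal colour. Put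
  \<open>B = \<Sum>\<^sub>c A\<^sub>c A\<^bsub>\<phi> c\<^esub> / k\<^sub>c\<close>. The Casimir relation gives \<open>A\<^sub>a B = B A\<^bsub>\<phi> a\<^esub>\<close>, hence
  \<open>B\<^sup>2 = B \<Sum>\<^sub>c A\<^sub>c\<^sup>2 / k\<^sub>c\<close>, and by pseudocyclicity the last sum is a combination of \<open>I\<close> and \<open>J\<close>.
  Since \<open>\<phi>\<close> fixes no other colour, the diagonal of \<open>B\<close> is 1, and the diagonal of \<open>B\<^sup>2\<close> then yields
  \<open>\<Sum>\<^sub>n (B\<^sub>l\<^sub>n - 1)\<^sup>2 = 0\<close>, that is \<open>B = J\<close>; off the diagonal this says
  \<open>\<Sum>\<^sub>c p\<^sup>b\<^bsub>c, \<phi> c\<^esub> = k\<close>.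

  For the elliptic scheme \<open>\<phi>\<close> is the Frobenius power \<open>\<sigma>\<close> and \<open>k = q + 1\<close>. The relation between
  \<open>(x, y)\<close> and \<open>(x + d\<^sub>2, y + d\<^sub>1)\<close> is given by \<open>F(d) = x\<^sup>2 d\<^sub>1\<^sup>2 + d\<^sub>1 d\<^sub>2 + y\<^sup>2 d\<^sub>2\<^sup>2\<close>, an anisotropic norm form. Its
  multiplicativity and \<open>Tr 1 = 1\<close> (\<open>m\<close> is odd) give the intersection numbers: \<open>p\<^sup>b\<^bsub>a, a'\<^esub>\<close> is the number
  of \<open>(w, g)\<close> with \<open>g\<^sup>2 + g w + w\<^sup>2 = a b\<close> and \<open>w\<^sup>2 + w = a + a' + b\<close>.
\<close>

section \<open>Pseudocyclic schemes\<close>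

locale symmetric_scheme =
  fixes X :: "'v set" and r :: "'v \<Rightarrow> 'v \<Rightarrow> 'c" and K :: "'c set" and z :: 'c and k :: nat
  assumes finite_X: "finite X" and finite_K: "finite K" and z_in: "z \<in> K"
    and r_in: "\<And>l n. l \<in> X \<Longrightarrow> n \<in> X \<Longrightarrow> r l n \<in> K"
    and r_sym: "\<And>l n. r l n = r n l"
    and r_eq_z: "\<And>l n. l \<in> X \<Longrightarrow> n \<in> X \<Longrightarrow> r l n = z \<longleftrightarrow> l = n"
    and valency: "\<And>l c. l \<in> X \<Longrightarrow> c \<in> K - {z} \<Longrightarrow> card {j \<in> X. r l j = c} = k"
    and k_pos: "k > 0"
    and regular: "\<And>a b l n l' n'. \<lbrakk>a \<in> K; b \<in> K; l \<in> X; n \<in> X; l' \<in> X; n' \<in> X; r l n = r l' n'\<rbrakk> \<Longrightarrow>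
      card {j \<in> X. r l j = a \<and> r j n = b} = card {j \<in> X. r l' j = a \<and> r j n' = b}"
begin

text \<open>The entry at \<open>(l, n)\<close> of the product of the adjacency matrices of
  \<open>a\<close> and \<open>b\<close>, kept real so that it can be divided by valencies.\<close>

definition triple :: "'c \<Rightarrow> 'c \<Rightarrow> 'v \<Rightarrow> 'v \<Rightarrow> real" where
  "triple a b l n = real (card {j \<in> X. r l j = a \<and> r j n = b})"

definition adj :: "'c \<Rightarrow> 'v \<Rightarrow> 'v \<Rightarrow> real" where
  "adj c l n = of_bool (r l n = c)"

definition val :: "'c \<Rightarrow> real" where
  "val c = (if c = z then 1 else real k)"

lemma val_pos: "val c > 0"
  using k_pos by (simp add: val_def)

lemma triple_adj: "triple a b l n = (\<Sum>j\<in>X. adj a l j * adj b j n)"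
  by (simp add: triple_def adj_def finite_X of_bool_conj[symmetric] Int_def)

lemma triple_regular:
  assumes "a \<in> K" "b \<in> K" "l \<in> X" "n \<in> X" "l' \<in> X" "n' \<in> X" "r l n = r l' n'"
  shows "triple a b l n = triple a b l' n'"
  unfolding triple_def using regular[OF assms] by simp

lemma triple_swap: "triple a b l n = triple b a n l"
  unfolding triple_def by (rule arg_cong[where f = "\<lambda>A. real (card A)"]) (auto simp: r_sym)

lemma triple_commute:
  assumes "a \<in> K" "b \<in> K" "l \<in> X" "n \<in> X"
  shows "triple a b l n = triple b a l n"
proof -
  have "triple a b l n = triple b a n l"
    by (rule triple_swap)
  also have "\<dots> = triple b a l n"
    by (rule triple_regular[OF assms(2,1,4,3,3,4) r_sym])
  finally show ?thesis .
qed

lemma sum_adj: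
  assumes "l \<in> X" "c \<in> K"
  shows "(\<Sum>j\<in>X. adj c l j) = val c"
proof (cases "c = z")
  case True
  have "{j \<in> X. r l j = z} = {l}"
    using assms r_eq_z by auto
  then show ?thesis
    using True by (simp add: adj_def val_def finite_X Int_def)
next
  case False
  then show ?thesis
    using assms valency[of l c] by (simp add: adj_def val_def finite_X Int_def)
qed

lemma triple_z:
  assumes "a \<in> K" "b \<in> K" "l \<in> X"
  shows "triple a b l l = (if a = b then val a else 0)"
proof (cases "a = b")
  case True
  have "triple a a l l = (\<Sum>j\<in>X. adj a l j)"
    unfolding triple_adj by (rule sum.cong) (auto simp: adj_def r_sym)
  then show ?thesis
    using True sum_adj assms by simp
next
  case False
  then have "{j \<in> X. r l j = a \<and> r j l = b} = {}"
    using r_sym by blast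
  then have "card {j \<in> X. r l j = a \<and> r j l = b} = 0"
    by (simp only: card.empty)
  then show ?thesis
    using False by (simp add: triple_def)
qed

text \<open>Double counting: with \<open>d = r l n\<close> and \<open>c = r l j\<close>, both sides
  count the pairs \<open>(h, i)\<close> with \<open>r l h = c\<close>, \<open>r h i = a\<close> and
  \<open>r l i = d\<close>, sorted by \<open>i\<close> on the left and by \<open>h\<close> on the
  right.\<close>

lemma triple_rotate:
  assumes "a \<in> K" "l \<in> X" "j \<in> X" "n \<in> X"
  shows "val (r l n) * triple (r l j) a l n = val (r l j) * triple (r l n) a l j"
proof -
  let ?d = "r l n" and ?c = "r l j"
  have dc: "?d \<in> K" "?c \<in> K"
    using assms r_in by auto
  have "(\<Sum>i\<in>X. adj ?d l i * triple ?c a l i) = (\<Sum>i\<in>X. adj ?d l i * triple ?c a l n)"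
    using triple_regular[OF dc(2) assms(1) assms(2) _ assms(2,4)]
    by (intro sum.cong) (auto simp: adj_def)
  then have 1: "val ?d * triple ?c a l n = (\<Sum>i\<in>X. adj ?d l i * triple ?c a l i)"
    using sum_adj[OF assms(2) dc(1)] by (simp add: sum_distrib_right[symmetric])
  have "(\<Sum>i\<in>X. adj ?c l i * triple ?d a l i) = (\<Sum>i\<in>X. adj ?c l i * triple ?d a l j)"
    using triple_regular[OF dc(1) assms(1) assms(2) _ assms(2,3)]
    by (intro sum.cong) (auto simp: adj_def)
  then have 2: "val ?c * triple ?d a l j = (\<Sum>i\<in>X. adj ?c l i * triple ?d a l i)"
    using sum_adj[OF assms(2) dc(2)] by (simp add: sum_distrib_right[symmetric])
  have "(\<Sum>i\<in>X. adj ?d l i * triple ?c a l i) = (\<Sum>i\<in>X. \<Sum>h\<in>X. adj ?d l i * adj ?c l h * adj a h i)"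
    by (simp add: triple_adj sum_distrib_left mult.assoc)
  also have "\<dots> = (\<Sum>h\<in>X. \<Sum>i\<in>X. adj ?d l i * adj ?c l h * adj a h i)"
    by (rule sum.swap)
  also have "\<dots> = (\<Sum>h\<in>X. adj ?c l h * triple ?d a l h)"
    by (simp add: triple_adj sum_distrib_left mult_ac adj_def r_sym)
  finally show ?thesis
    using 1 2 by simp
qed

lemma colour_attained:
  assumes "l \<in> X" "c \<in> K"
  obtains n where "n \<in> X" "r l n = c"
proof (cases "c = z")
  case True
  then show ?thesis
    using assms that r_eq_z by blast
next
  case False
  then have "card {n \<in> X. r l n = c} > 0"
    using assms valency k_pos by simp
  then have "{n \<in> X. r l n = c} \<noteq> {}"
    by (metis card.empty less_irrefl)
  then show ?thesis
    using that by blast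
qed

text \<open>The Casimir relation in terms of colours alone. Detaching the second pair from the base
  point \<open>l\<close> allows it to be a pair pulled back along the automorphism.\<close>

lemma triple_rotate_colour:
  assumes "a \<in> K" "l \<in> X" "j \<in> X" "l' \<in> X" "n' \<in> X"
  shows "triple a (r l' n') l j / val (r l' n') = triple (r l j) a l' n' / val (r l j)"
proof -
  have c: "r l' n' \<in> K" "r l j \<in> K"
    using assms r_in by auto
  obtain n where n: "n \<in> X" "r l n = r l' n'"
    using colour_attained assms(2) c by blast
  have "val (r l n) * triple (r l j) a l n = val (r l j) * triple (r l n) a l j"
    using triple_rotate assms n by blast
  moreover have "triple (r l j) a l n = triple (r l j) a l' n'"
    using triple_regular c assms n by blast
  moreover have "triple (r l n) a l j = triple a (r l n) l j"
    using triple_commute c assms n by simp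
  ultimately show ?thesis
    using val_pos[of "r l' n'"] val_pos[of "r l j"] n by (simp add: field_simps)
qed

lemma sum_val: "l \<in> X \<Longrightarrow> (\<Sum>c\<in>K. val c) = real (card X)"
proof -
  assume l: "l \<in> X"
  have "(\<Sum>c\<in>K. val c) = (\<Sum>c\<in>K. \<Sum>j\<in>X. adj c l j)"
    using l by (intro sum.cong) (simp_all add: sum_adj)
  also have "\<dots> = (\<Sum>j\<in>X. \<Sum>c\<in>K. adj c l j)"
    by (rule sum.swap)
  also have "\<dots> = (\<Sum>j\<in>X. \<Sum>c\<in>K. if c = r l j then 1 else 0)"
    by (intro sum.cong) (auto simp: adj_def)
  also have "\<dots> = real (card X)"
    using l r_in finite_K by simp
  finally show ?thesis .
qed

end

section \<open>Colour automorphisms and the twisted Casimir matrix\<close>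

locale scheme_automorphism = symmetric_scheme X r K z k
  for X :: "'v set" and r :: "'v \<Rightarrow> 'v \<Rightarrow> 'c" and K z k +
  fixes \<phi> :: "'c \<Rightarrow> 'c" and \<Phi> :: "'v \<Rightarrow> 'v"
  assumes auto_vertex: "bij_betw \<Phi> X X" and auto_colour: "bij_betw \<phi> K K"
    and auto_r: "\<And>l n. l \<in> X \<Longrightarrow> n \<in> X \<Longrightarrow> r (\<Phi> l) (\<Phi> n) = \<phi> (r l n)"
    and auto_fixed: "\<And>c. c \<in> K \<Longrightarrow> \<phi> c = c \<longleftrightarrow> c = z"
    and pseudocyclic: "\<And>l n. l \<in> X \<Longrightarrow> n \<in> X \<Longrightarrow> l \<noteq> n \<Longrightarrow>
      (\<Sum>c\<in>K - {z}. card {j \<in> X. r l j = c \<and> r j n = c}) = k - 1"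
begin

lemma auto_in: "c \<in> K \<Longrightarrow> \<phi> c \<in> K"
  using auto_colour by (auto simp: bij_betw_def)

lemma auto_inj: "a \<in> K \<Longrightarrow> b \<in> K \<Longrightarrow> \<phi> a = \<phi> b \<longleftrightarrow> a = b"
  using auto_colour by (auto simp: bij_betw_def inj_on_eq_iff)

lemma val_auto: "c \<in> K \<Longrightarrow> val (\<phi> c) = val c"
  using auto_inj[of c z] auto_fixed[of z] z_in by (auto simp: val_def)

lemma triple_auto:
  assumes "a \<in> K" "b \<in> K" "l \<in> X" "n \<in> X"
  shows "triple (\<phi> a) (\<phi> b) (\<Phi> l) (\<Phi> n) = triple a b l n"
proof -
  have \<Phi>: "inj_on \<Phi> X" "\<Phi> ` X = X"
    using auto_vertex by (auto simp: bij_betw_def)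
  have "(\<Sum>j\<in>\<Phi> ` X. adj (\<phi> a) (\<Phi> l) j * adj (\<phi> b) j (\<Phi> n))
    = (\<Sum>j\<in>X. adj (\<phi> a) (\<Phi> l) (\<Phi> j) * adj (\<phi> b) (\<Phi> j) (\<Phi> n))"
    using sum.reindex[OF \<Phi>(1)] by simp
  also have "\<dots> = (\<Sum>j\<in>X. adj a l j * adj b j n)"
    using assms by (intro sum.cong) (auto simp: adj_def auto_r auto_inj r_in)
  finally show ?thesis
    by (simp add: triple_adj \<Phi>(2))
qed

text \<open>The matrix \<open>B\<close> of the outline.\<close>

definition twist :: "'v \<Rightarrow> 'v \<Rightarrow> real" where
  "twist l n = (\<Sum>c\<in>K. triple c (\<phi> c) l n / val c)"

lemma twist_regular:
  assumes "l \<in> X" "n \<in> X" "l' \<in> X" "n' \<in> X" "r l n = r l' n'"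
  shows "twist l n = twist l' n'"
  unfolding twist_def
  using triple_regular[OF _ auto_in assms] by (intro sum.cong) auto

lemma twist_sym: "l \<in> X \<Longrightarrow> n \<in> X \<Longrightarrow> twist l n = twist n l"
  using twist_regular r_sym by metis

lemma twist_diag:
  assumes "l \<in> X"
  shows "twist l l = 1"
proof -
  have "triple c (\<phi> c) l l / val c = (if c = z then 1 else 0)" if "c \<in> K" for c
    using that assms auto_fixed[of c] triple_z[of c "\<phi> c" l] val_pos[of c] by (auto simp: auto_in)
  then show ?thesis
    by (simp add: twist_def finite_K z_in)
qed

(* twist is the image of the Casimir element of the adjacency algebra twisted by the automorphism *)
lemma adj_twist_commute:
  assumes "a \<in> K" "l \<in> X" "n \<in> X"
  shows "(\<Sum>j\<in>X. adj a l j * twist j n) = (\<Sum>j\<in>X. twist l j * adj (\<phi> a) j n)"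
proof -
  \<comment> \<open>The two products already agree for each middle vertex \<open>j\<close>. Only the
    colour with \<open>\<phi> c = r j n\<close> survives on the left and only
    \<open>c = r l j\<close> on the right; pulling \<open>j\<close> and \<open>n\<close> back along
    \<open>\<Phi>\<close> leaves one instance of the Casimir relation.\<close>
  have one: "(\<Sum>c\<in>K. triple a c l j / val c * adj (\<phi> c) j n)
    = (\<Sum>c\<in>K. adj c l j * triple (\<phi> c) (\<phi> a) j n / val c)" if j: "j \<in> X" for j
  proof -
    have "\<phi> ` K = K" "\<Phi> ` X = X"
      using auto_colour auto_vertex by (auto simp: bij_betw_def)
    then obtain c j' n' where c: "c \<in> K" "\<phi> c = r j n"
      and jn: "j' \<in> X" "n' \<in> X" "\<Phi> j' = j" "\<Phi> n' = n"
      using r_in[OF j assms(3)] j assms(3) by (metis imageE)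
    then have rc: "r j' n' = c"
      using auto_r c auto_inj r_in by metis
    have "(\<Sum>c\<in>K. triple a c l j / val c * adj (\<phi> c) j n) = (\<Sum>d\<in>K. if d = c then triple a c l j / val c else 0)"
      using c auto_inj by (intro sum.cong) (auto simp: adj_def)
    also have "\<dots> = triple a c l j / val c"
      using c finite_K by simp
    finally have L: "(\<Sum>c\<in>K. triple a c l j / val c * adj (\<phi> c) j n) = triple a c l j / val c" .
    let ?d = "r l j"
    have d: "?d \<in> K"
      using r_in assms j by auto
    have "(\<Sum>c\<in>K. adj c l j * triple (\<phi> c) (\<phi> a) j n / val c)
      = (\<Sum>c\<in>K. if c = ?d then triple (\<phi> ?d) (\<phi> a) j n / val ?d else 0)"
      by (intro sum.cong) (auto simp: adj_def)
    also have "\<dots> = triple ?d a j' n' / val ?d"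
      using triple_auto[of ?d a j' n'] jn d assms finite_K by simp
    finally have R: "(\<Sum>c\<in>K. adj c l j * triple (\<phi> c) (\<phi> a) j n / val c) = triple ?d a j' n' / val ?d" .
    show ?thesis
      unfolding L R using triple_rotate_colour[OF assms(1,2) j jn(1,2)] rc by simp
  qed
  have "(\<Sum>i\<in>X. adj a l i * twist i n)
    = (\<Sum>i\<in>X. \<Sum>c\<in>K. \<Sum>j\<in>X. adj a l i * (adj c i j * adj (\<phi> c) j n) / val c)"
    by (simp add: twist_def triple_adj sum_distrib_left sum_divide_distrib)
  also have "\<dots> = (\<Sum>c\<in>K. \<Sum>i\<in>X. \<Sum>j\<in>X. adj a l i * (adj c i j * adj (\<phi> c) j n) / val c)"
    by (rule sum.swap)
  also have "\<dots> = (\<Sum>c\<in>K. \<Sum>j\<in>X. \<Sum>i\<in>X. adj a l i * (adj c i j * adj (\<phi> c) j n) / val c)"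
    by (intro sum.cong refl sum.swap)
  also have "\<dots> = (\<Sum>j\<in>X. \<Sum>c\<in>K. \<Sum>i\<in>X. adj a l i * (adj c i j * adj (\<phi> c) j n) / val c)"
    by (rule sum.swap)
  also have "\<dots> = (\<Sum>j\<in>X. \<Sum>c\<in>K. triple a c l j / val c * adj (\<phi> c) j n)"
    by (simp add: triple_adj sum_distrib_right sum_divide_distrib mult.assoc)
  also have "\<dots> = (\<Sum>j\<in>X. \<Sum>c\<in>K. adj c l j * triple (\<phi> c) (\<phi> a) j n / val c)"
    using one by (rule sum.cong[OF refl])
  also have "\<dots> = (\<Sum>j\<in>X. \<Sum>c\<in>K. \<Sum>i\<in>X. adj c l j * adj (\<phi> c) j i / val c * adj (\<phi> a) i n)"
    by (simp add: triple_adj sum_distrib_left sum_divide_distrib mult.assoc)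
  also have "\<dots> = (\<Sum>c\<in>K. \<Sum>j\<in>X. \<Sum>i\<in>X. adj c l j * adj (\<phi> c) j i / val c * adj (\<phi> a) i n)"
    by (rule sum.swap)
  also have "\<dots> = (\<Sum>c\<in>K. \<Sum>i\<in>X. \<Sum>j\<in>X. adj c l j * adj (\<phi> c) j i / val c * adj (\<phi> a) i n)"
    by (intro sum.cong refl sum.swap)
  also have "\<dots> = (\<Sum>i\<in>X. \<Sum>c\<in>K. \<Sum>j\<in>X. adj c l j * adj (\<phi> c) j i / val c * adj (\<phi> a) i n)"
    by (rule sum.swap)
  also have "\<dots> = (\<Sum>i\<in>X. twist l i * adj (\<phi> a) i n)"
    by (simp add: twist_def triple_adj sum_distrib_right sum_divide_distrib)
  finally show ?thesis .
qed

text \<open>\<open>twist\<close> is constant on colours, hence a linear combination of adjacency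
  matrices, and these commute because the scheme is symmetric.\<close>

lemma adj_twist_commute_plain:
  assumes "a \<in> K" "l \<in> X" "n \<in> X"
  shows "(\<Sum>j\<in>X. adj a l j * twist j n) = (\<Sum>j\<in>X. twist l j * adj a j n)"
proof -
  \<comment> \<open>The vertex \<open>v c\<close> represents the colour \<open>c\<close> as seen
    from \<open>l\<close>, so that \<open>twist l (v c)\<close> is the coefficient of
    \<open>adj c\<close>.\<close>
  have "\<forall>c\<in>K. \<exists>n. n \<in> X \<and> r l n = c"
    using colour_attained[OF assms(2)] by blast
  from bchoice[OF this] obtain v where v: "v c \<in> X" "r l (v c) = c" if "c \<in> K" for c
    by blast
  have twist: "twist i j = (\<Sum>c\<in>K. twist l (v c) * adj c i j)" if "i \<in> X" "j \<in> X" for i j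
  proof -
    have c: "r i j \<in> K"
      using that r_in by auto
    have "(\<Sum>c\<in>K. twist l (v c) * adj c i j) = (\<Sum>c\<in>K. if c = r i j then twist l (v (r i j)) else 0)"
      by (intro sum.cong) (auto simp: adj_def)
    also have "\<dots> = twist i j"
      using c v[OF c] that assms finite_K twist_regular[of l "v (r i j)" i j] by simp
    finally show ?thesis
      by simp
  qed
  have "(\<Sum>j\<in>X. adj a l j * twist j n) = (\<Sum>j\<in>X. \<Sum>c\<in>K. twist l (v c) * (adj a l j * adj c j n))"
    using assms by (intro sum.cong) (auto simp: twist sum_distrib_left mult_ac)
  also have "\<dots> = (\<Sum>c\<in>K. \<Sum>j\<in>X. twist l (v c) * (adj a l j * adj c j n))"
    by (rule sum.swap)
  also have "\<dots> = (\<Sum>c\<in>K. twist l (v c) * triple a c l n)"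
    by (simp add: triple_adj sum_distrib_left)
  also have "\<dots> = (\<Sum>c\<in>K. twist l (v c) * triple c a l n)"
    using assms triple_commute by (intro sum.cong) auto
  also have "\<dots> = (\<Sum>c\<in>K. \<Sum>j\<in>X. twist l (v c) * (adj c l j * adj a j n))"
    by (simp add: triple_adj sum_distrib_left)
  also have "\<dots> = (\<Sum>j\<in>X. \<Sum>c\<in>K. twist l (v c) * (adj c l j * adj a j n))"
    by (rule sum.swap)
  also have "\<dots> = (\<Sum>j\<in>X. twist l j * adj a j n)"
    using assms by (intro sum.cong) (auto simp: twist[OF assms(2)] sum_distrib_left mult_ac)
  finally show ?thesis .
qed

text \<open>The matrices of \<open>c\<close> and \<open>\<phi> c\<close> have row sums
  \<open>val c\<close> and \<open>val (\<phi> c) = val c\<close>. After the division each colour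
  contributes \<open>val c\<close>, and the valencies add up to the number of vertices.\<close>

lemma twist_row_sum:
  assumes "l \<in> X"
  shows "(\<Sum>n\<in>X. twist l n) = real (card X)"
proof -
  have "(\<Sum>n\<in>X. twist l n) = (\<Sum>n\<in>X. \<Sum>c\<in>K. \<Sum>j\<in>X. adj c l j * adj (\<phi> c) j n / val c)"
    by (simp add: twist_def triple_adj sum_divide_distrib)
  also have "\<dots> = (\<Sum>c\<in>K. \<Sum>n\<in>X. \<Sum>j\<in>X. adj c l j * adj (\<phi> c) j n / val c)"
    by (rule sum.swap)
  also have "\<dots> = (\<Sum>c\<in>K. \<Sum>j\<in>X. \<Sum>n\<in>X. adj c l j * adj (\<phi> c) j n / val c)"
    by (intro sum.cong refl sum.swap)
  also have "\<dots> = (\<Sum>c\<in>K. \<Sum>j\<in>X. adj c l j * (\<Sum>n\<in>X. adj (\<phi> c) j n) / val c)"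
    by (simp add: sum_distrib_left sum_divide_distrib)
  also have "\<dots> = (\<Sum>c\<in>K. \<Sum>j\<in>X. adj c l j)"
  proof (intro sum.cong refl)
    fix c j assume "c \<in> K" "j \<in> X"
    then show "adj c l j * (\<Sum>n\<in>X. adj (\<phi> c) j n) / val c = adj c l j"
      using sum_adj[of j "\<phi> c"] val_auto[of c] auto_in[of c] val_pos[of c] by simp
  qed
  also have "\<dots> = (\<Sum>c\<in>K. val c)"
    using assms sum_adj by (intro sum.cong) auto
  finally show ?thesis
    using sum_val[OF assms] by simp
qed

text \<open>On the diagonal every colour contributes 1. Off it, \<open>z\<close> contributes nothing
  and all other colours share the valency \<open>k\<close>, so \<open>pseudocyclic\<close> evaluates
  the sum.\<close>

lemma sum_triple_same:
  assumes "l \<in> X" "n \<in> X"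
  shows "(\<Sum>c\<in>K. triple c c n l / val c) = (if n = l then real (card K) else (real k - 1) / real k)"
proof (cases "n = l")
  case True
  have "triple c c l l / val c = 1" if "c \<in> K" for c
    using that assms triple_z[of c c l] val_pos[of c] by simp
  then have "(\<Sum>c\<in>K. triple c c l l / val c) = (\<Sum>c\<in>K. 1)"
    by (rule sum.cong[OF refl])
  then show ?thesis
    using True by simp
next
  case False
  have "triple z z n l = 0"
    using False assms r_eq_z unfolding triple_adj by (intro sum.neutral) (auto simp: adj_def)
  then have "(\<Sum>c\<in>K. triple c c n l / val c) = (\<Sum>c\<in>K - {z}. triple c c n l / val c)"
    using sum.remove[OF finite_K z_in, of "\<lambda>c. triple c c n l / val c"] by simp
  also have "\<dots> = real (\<Sum>c\<in>K - {z}. card {j \<in> X. r n j = c \<and> r j l = c}) / real k"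
    by (simp add: sum_divide_distrib val_def triple_def)
  also have "\<dots> = (real k - 1) / real k"
    using pseudocyclic[OF assms(2,1) False] k_pos by (simp add: of_nat_diff)
  finally show ?thesis
    using False by simp
qed

lemma twist_square_sum:
  assumes "l \<in> X"
  shows "(\<Sum>n\<in>X. twist l n * twist n l) = (\<Sum>n\<in>X. twist l n * (\<Sum>c\<in>K. triple c c n l / val c))"
proof -
  have "(\<Sum>n\<in>X. twist l n * twist n l) = (\<Sum>n\<in>X. twist l n * (\<Sum>c\<in>K. triple (\<phi> c) c n l / val c))"
    unfolding twist_def[of _ l] using assms triple_commute auto_in by (intro sum.cong arg_cong2[where f = "(*)"]) auto
  also have "\<dots> = (\<Sum>n\<in>X. \<Sum>c\<in>K. \<Sum>j\<in>X. twist l n * adj (\<phi> c) n j * adj c j l / val c)"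
    by (simp add: triple_adj sum_distrib_left sum_divide_distrib mult_ac)
  also have "\<dots> = (\<Sum>c\<in>K. \<Sum>n\<in>X. \<Sum>j\<in>X. twist l n * adj (\<phi> c) n j * adj c j l / val c)"
    by (rule sum.swap)
  also have "\<dots> = (\<Sum>c\<in>K. \<Sum>j\<in>X. \<Sum>n\<in>X. twist l n * adj (\<phi> c) n j * adj c j l / val c)"
    by (intro sum.cong refl sum.swap)
  also have "\<dots> = (\<Sum>c\<in>K. \<Sum>j\<in>X. (\<Sum>n\<in>X. twist l n * adj (\<phi> c) n j) * adj c j l / val c)"
    by (simp add: sum_distrib_right sum_divide_distrib)
  also have "\<dots> = (\<Sum>c\<in>K. \<Sum>j\<in>X. (\<Sum>n\<in>X. twist l n * adj c n j) * adj c j l / val c)"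
    using assms adj_twist_commute[of _ l] adj_twist_commute_plain[of _ l] by (intro sum.cong) auto
  also have "\<dots> = (\<Sum>c\<in>K. \<Sum>j\<in>X. \<Sum>n\<in>X. twist l n * adj c n j * adj c j l / val c)"
    by (simp add: sum_distrib_right sum_divide_distrib)
  also have "\<dots> = (\<Sum>c\<in>K. \<Sum>n\<in>X. \<Sum>j\<in>X. twist l n * adj c n j * adj c j l / val c)"
    by (intro sum.cong refl sum.swap)
  also have "\<dots> = (\<Sum>n\<in>X. \<Sum>c\<in>K. \<Sum>j\<in>X. twist l n * adj c n j * adj c j l / val c)"
    by (rule sum.swap)
  also have "\<dots> = (\<Sum>n\<in>X. twist l n * (\<Sum>c\<in>K. triple c c n l / val c))"
    by (simp add: triple_adj sum_distrib_left sum_divide_distrib mult_ac)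
  finally show ?thesis .
qed

lemma twist_eq_1:
  assumes "l \<in> X" "n \<in> X"
  shows "twist l n = 1"
proof -
  let ?S = "\<Sum>n\<in>X. twist l n * twist n l"
  define g where "g = (real k - 1) / real k"
  have K1: "card K > 0"
    using finite_K z_in card_gt_0_iff by blast
  have X: "real (card X) = 1 + (real (card K) - 1) * real k"
  proof -
    have "real (card X) = val z + (\<Sum>c\<in>K - {z}. val c)"
      using sum_val[OF assms(1)] sum.remove[OF finite_K z_in, of val] by simp
    also have "(\<Sum>c\<in>K - {z}. val c) = (real (card K) - 1) * real k"
      using K1 z_in by (simp add: val_def card_Diff_singleton of_nat_diff)
    finally show ?thesis
      by (simp add: val_def)
  qed
  have "?S = (\<Sum>n\<in>X. twist l n * (if n = l then real (card K) else g))"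
    unfolding twist_square_sum[OF assms(1)] using assms sum_triple_same by (intro sum.cong) (auto simp: g_def)
  also have "\<dots> = (\<Sum>n\<in>X. g * twist l n + (if n = l then (real (card K) - g) * twist l n else 0))"
    by (intro sum.cong) (auto simp: algebra_simps)
  also have "\<dots> = g * real (card X) + (real (card K) - g)"
    using assms finite_X twist_diag[OF assms(1)] twist_row_sum[OF assms(1)]
    by (simp add: sum.distrib sum_distrib_left[symmetric])
  \<comment> \<open>Since \<open>g * k = k - 1\<close>, the left side is
    \<open>(k - 1) * (card K - 1) + card K\<close>.\<close>
  also have "\<dots> = real (card X)"
    using k_pos unfolding X g_def by (simp add: field_simps)
  finally have S: "?S = real (card X)" .
  have "(\<Sum>n\<in>X. (twist l n - 1)\<^sup>2) = (\<Sum>n\<in>X. twist l n * twist n l - 2 * twist l n + 1)"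
    using assms twist_sym by (intro sum.cong) (auto simp: power2_eq_square algebra_simps)
  also have "\<dots> = 0"
    using S twist_row_sum[OF assms(1)] by (simp add: sum.distrib sum_subtractf sum_distrib_left[symmetric])
  finally show ?thesis
    using assms finite_X by (simp add: sum_nonneg_eq_0_iff)
qed

theorem sum_twisted_intersection_numbers:
  assumes "l \<in> X" "n \<in> X" "l \<noteq> n"
  shows "(\<Sum>c\<in>K - {z}. card {j \<in> X. r l j = c \<and> r j n = \<phi> c}) = k"
proof -
  have "triple z (\<phi> z) l n = 0"
    using assms r_eq_z auto_fixed[OF z_in] unfolding triple_adj
    by (intro sum.neutral) (auto simp: adj_def)
  then have "twist l n = (\<Sum>c\<in>K - {z}. triple c (\<phi> c) l n / val c)"
    unfolding twist_def using sum.remove[OF finite_K z_in, of "\<lambda>c. triple c (\<phi> c) l n / val c"] by simp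
  also have "\<dots> = real (\<Sum>c\<in>K - {z}. card {j \<in> X. r l j = c \<and> r j n = \<phi> c}) / real k"
    by (simp add: sum_divide_distrib val_def triple_def)
  finally have "real (\<Sum>c\<in>K - {z}. card {j \<in> X. r l j = c \<and> r j n = \<phi> c}) = real k"
    using twist_eq_1 assms k_pos by simp
  then show ?thesis
    using of_nat_eq_iff by blast
qed

end

section \<open>Fields of even order and odd degree\<close>

lemma finite_field_power_CARD:
  fixes x :: "'a::{field,finite}"
  shows "x ^ CARD('a) = x"
proof (cases "x = 0")
  case True
  then show ?thesis by (simp add: zero_power)
next
  case False
  have "(\<Prod>y\<in>UNIV - {0}. x * y) = (\<Prod>y\<in>UNIV - {0}. y)"
    by (rule prod.reindex_bij_witness[where i = "\<lambda>y. y / x" and j = "\<lambda>y. x * y"])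
      (use False in auto)
  then have "x ^ (CARD('a) - 1) * (\<Prod>y\<in>UNIV - {0}. y) = (\<Prod>y\<in>UNIV - {0 :: 'a}. y)"
    by (simp add: prod.distrib card_Diff_singleton)
  moreover have "(\<Prod>y\<in>UNIV - {0 :: 'a}. y) \<noteq> 0"
    by simp
  ultimately have "x ^ (CARD('a) - 1) = 1"
    by simp
  then show ?thesis
    using power_minus_mult[of "CARD('a)" x] by simp
qed

lemma card_fiber_additive:
  fixes f :: "'a::{ab_group_add,finite} \<Rightarrow> 'b::ab_group_add"
  assumes add: "\<And>x y. f (x + y) = f x + f y"
  shows "card {x. f x = f y} = card {x. f x = 0}"
proof -
  have zero: "f 0 = 0"
    using add[of 0 0] by simp
  have neg: "f (- x) = - f x" for x
    using add[of x "- x"] by (simp add: zero add_eq_0_iff)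
  show ?thesis
    by (rule bij_betw_same_card[of "\<lambda>x. x - y"], rule bij_betw_byWitness[where f' = "\<lambda>x. x + y"])
      (auto simp: add neg add[of _ "- _", simplified])
qed

locale odd_binary_field =
  fixes m :: nat and tr :: "'a::{field,finite} \<Rightarrow> 'a"
  assumes odd_degree: "odd m" and card_field: "CARD('a) = 2 ^ m" and tr_def: "tr = abs_trace m"
begin

section \<open>Characteristic two and the Frobenius map\<close>

lemma two_eq_0 [simp]: "(2::'a) = 0"
proof -
  \<comment> \<open>Translation by 1 permutes the field, so a sum of \<open>2 ^ m\<close> ones
    vanishes.\<close>
  have "(\<Sum>x\<in>UNIV. x + 1) = (\<Sum>x\<in>UNIV. x :: 'a)"
    by (rule sum.reindex_bij_witness[where i = "\<lambda>x. x - 1" and j = "\<lambda>x. x + 1"]) auto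
  then have "(2::'a) ^ m = 0"
    by (simp add: sum.distrib card_field)
  then show ?thesis
    by simp
qed

lemma add_self [simp]: "x + x = (0::'a)"
  using mult_2[of x] by simp

lemma add_self_left [simp]: "x + (x + y) = (y::'a)"
  by (simp add: add.assoc[symmetric])

lemma add_eq_0 [simp]: "x + y = 0 \<longleftrightarrow> x = (y::'a)"
  by (metis add_self add_self_left add.right_neutral)

lemma square_add: "(x + y)\<^sup>2 = x\<^sup>2 + (y::'a)\<^sup>2"
  by (simp add: power2_sum)

lemma frob_add: "(x + y) ^ 2 ^ i = x ^ 2 ^ i + (y::'a) ^ 2 ^ i"
  by (induction i) (simp_all add: power_mult square_add mult.commute[of 2])

lemma frob_inj: "x ^ 2 ^ i = y ^ 2 ^ i \<longleftrightarrow> x = (y::'a)"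
proof
  assume "x ^ 2 ^ i = y ^ 2 ^ i"
  then have "(x + y) ^ 2 ^ i = 0"
    by (simp add: frob_add)
  then show "x = y"
    by simp
qed simp

lemma square_inj: "x\<^sup>2 = y\<^sup>2 \<longleftrightarrow> x = (y::'a)"
  using frob_inj[of x 1] by simp

lemma square_surj: obtains y where "x = (y::'a)\<^sup>2"
proof -
  have "inj (\<lambda>y::'a. y\<^sup>2)"
    by (simp add: inj_def square_inj)
  then show ?thesis
    using finite_UNIV_inj_surj[of "\<lambda>y::'a. y\<^sup>2"] that by (metis finite surjD)
qed

lemma power_card: "x ^ 2 ^ m = (x::'a)"
  using finite_field_power_CARD[of x] by (simp add: card_field)

section \<open>The absolute trace\<close>

lemma tr_add: "tr (x + y) = tr x + tr y"
  by (simp add: tr_def abs_trace_def frob_add sum.distrib)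

lemma tr_0 [simp]: "tr 0 = 0"
  using tr_add[of 0 0] by simp

lemma tr_1 [simp]: "tr 1 = 1"
proof -
  obtain n where "m = Suc (2 * n)"
    using odd_degree by (metis oddE Suc_eq_plus1)
  then show ?thesis
    by (simp add: tr_def abs_trace_def)
qed

lemma tr_square_right: "(tr x)\<^sup>2 = tr (x\<^sup>2)"
proof -
  have "(\<Sum>i\<in>I. f i)\<^sup>2 = (\<Sum>i\<in>I. (f i :: 'a)\<^sup>2)" if "finite I" for I :: "nat set" and f
    using that by (induction I) (simp_all add: square_add)
  then show ?thesis
    by (simp add: tr_def abs_trace_def power_mult[symmetric] mult.commute)
qed

text \<open>Squaring shifts the exponents by one. Adding \<open>x\<close> to either side gives the
  same sum over \<open>i < Suc m\<close>, because the top term \<open>x ^ 2 ^ m\<close> equals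
  \<open>x\<close>.\<close>

lemma tr_square [simp]: "tr (x\<^sup>2) = tr x"
proof -
  have "tr (x\<^sup>2) + x = (\<Sum>i<Suc m. x ^ 2 ^ i)"
    unfolding sum.lessThan_Suc_shift
    by (simp add: tr_def abs_trace_def power_mult[symmetric] mult.commute add.commute)
  also have "\<dots> = tr x + x"
    by (simp add: tr_def abs_trace_def power_card)
  finally show ?thesis
    by simp
qed

lemma tr_frob: "tr (x ^ 2 ^ i) = tr x"
  by (induction i) (simp_all add: power_mult mult.commute[of 2])

lemma tr_cases: "tr x = 0 \<or> tr x = 1"
proof -
  have "(tr x)\<^sup>2 = tr x"
    by (simp add: tr_square_right)
  then have "tr x * (tr x + 1) = 0"
    by (simp add: distrib_left power2_eq_square)
  then show ?thesis
    by auto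
qed

lemma card_tr_fiber:
  shows "2 * card {x. tr x = 0} = 2 ^ m" and "2 * card {x. tr x = 1} = 2 ^ m"
proof -
  have eq: "card {x. tr x = 1} = card {x. tr x = 0}"
    using card_fiber_additive[of tr 1] by (simp add: tr_add)
  have "2 ^ m = card ({x. tr x = 0} \<union> {x. tr x = 1})"
    using tr_cases by (simp add: card_field[symmetric] Collect_disj_eq[symmetric])
  also have "\<dots> = card {x. tr x = 0} + card {x. tr x = 1}"
    by (rule card_Un_disjoint) auto
  finally show "2 * card {x. tr x = 0} = 2 ^ m" and "2 * card {x. tr x = 1} = 2 ^ m"
    by (simp_all add: eq)
qed

lemma square_add_self_eq_iff: "s\<^sup>2 + s = t\<^sup>2 + t \<longleftrightarrow> s = t \<or> s = t + (1::'a)"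
proof -
  have "s\<^sup>2 + s = t\<^sup>2 + t \<longleftrightarrow> (s\<^sup>2 + s) + (t\<^sup>2 + t) = 0"
    by (rule add_eq_0[symmetric])
  also have "(s\<^sup>2 + s) + (t\<^sup>2 + t) = (s + t) * (s + t + 1)"
    by (simp add: algebra_simps power2_eq_square)
  also have "(s + t) * (s + t + 1) = 0 \<longleftrightarrow> s = t \<or> s = t + 1"
    by (auto simp: add.assoc)
  finally show ?thesis .
qed

text \<open>Additive Hilbert 90. As \<open>tr 1 = 1\<close>, the elements \<open>t\<close> and
  \<open>t + 1\<close> have different traces, so \<open>t\<^sup>2 + t\<close> is injective on the
  kernel of \<open>tr\<close>; it maps this finite set into itself, hence onto.\<close>

lemma tr_eq_0_imp: 
  assumes "tr x = 0" 
  obtains t where "t\<^sup>2 + t = x"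
proof -
  have inj: "inj_on (\<lambda>t. t\<^sup>2 + t) {t. tr t = 0}"
    by (auto simp: inj_on_def square_add_self_eq_iff tr_add)
  have "(\<lambda>t. t\<^sup>2 + t) ` {t. tr t = 0} = {t. tr t = 0}"
    by (rule endo_inj_surj[OF _ _ inj]) (auto simp: tr_add)
  then show ?thesis
    using assms that by (metis (mono_tags, lifting) imageE mem_Collect_eq)
qed

lemma card_square_add_self:
  assumes "tr x = 0"
  shows "card {t. t\<^sup>2 + t = x} = 2"
proof -
  obtain t where "t\<^sup>2 + t = x"
    using tr_eq_0_imp assms by blast
  then have "{s. s\<^sup>2 + s = x} = {t, t + 1}"
    by (auto simp: square_add_self_eq_iff)
  then show ?thesis
    by simp
qed

text \<open>Bezout turns the fixed point equations for the exponents \<open>k\<close> and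
  \<open>m\<close> into \<open>x = x\<^sup>2\<close>, so \<open>x\<close> is 0 or 1, and
  \<open>tr 1 = 1\<close> excludes 1.\<close>

lemma frob_fixed:
  assumes "coprime k m" and fixed: "x ^ 2 ^ k = (x::'a)" and "tr x = 0"
  shows "x = 0"
proof -
  have pow: "x ^ 2 ^ (n * i) = x" if "x ^ 2 ^ n = x" for n i
    by (induction i) (simp_all add: that power_add power_mult)
  have "m \<noteq> 0"
    using odd_pos[OF odd_degree] by simp
  then obtain u v where "m * u = k * v + 1"
    using bezout_nat[of m k] assms(1) by (auto simp: coprime_iff_gcd_eq_1 gcd.commute)
  then have "x = (x ^ 2 ^ (k * v))\<^sup>2"
    using pow[of m u] by (simp add: power_card power_mult[symmetric] mult.commute)
  then have "x * (x + 1) = 0"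
    by (simp add: pow fixed algebra_simps power2_eq_square)
  then show ?thesis
    using assms(3) by auto
qed

end

section \<open>The elliptic scheme in coordinates\<close>

definition rho :: "'a::field \<times> 'a \<Rightarrow> 'a \<times> 'a \<Rightarrow> 'a" where
  "rho l n = (case l of (x, y) \<Rightarrow> case n of (z, u) \<Rightarrow>
     x\<^sup>2 * u\<^sup>2 + y\<^sup>2 * z\<^sup>2 + (x + z) * (y + u))"

lemma rho_simp: "rho (x, y) (z, u) = x\<^sup>2 * u\<^sup>2 + y\<^sup>2 * z\<^sup>2 + (x + z) * (y + u)"
  by (simp add: rho_def)

lemma rho_sym: "rho l n = rho n l"
  by (cases l; cases n) (simp add: rho_simp algebra_simps)

context odd_binary_field
begin

section \<open>Coordinates of exterior lines and the norm form\<close>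

definition pts :: "('a \<times> 'a) set" where
  "pts = {(x, y). tr (x * y) = 1}"

definition form :: "'a \<times> 'a \<Rightarrow> 'a \<times> 'a \<Rightarrow> 'a" where
  "form l d = (case l of (x, y) \<Rightarrow> case d of (d1, d2) \<Rightarrow> x\<^sup>2 * d1\<^sup>2 + d1 * d2 + y\<^sup>2 * d2\<^sup>2)"

text \<open>The coordinates are swapped so that rho becomes a quadratic form in the displacement.\<close>

definition diff :: "'a \<times> 'a \<Rightarrow> 'a \<times> 'a \<Rightarrow> 'a \<times> 'a" where
  "diff l j = (snd l + snd j, fst l + fst j)"

text \<open>In characteristic two this determinant is the polar form of \<open>form l\<close>, the
  same for every \<open>l\<close>.\<close>

definition alt :: "'a \<times> 'a \<Rightarrow> 'a \<times> 'a \<Rightarrow> 'a" where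
  "alt d e = fst d * snd e + snd d * fst e"

lemma rho_form: "rho l j = form l (diff l j)"
  by (cases l; cases j) (simp add: rho_simp form_def diff_def square_add algebra_simps)

text \<open>The displacement from \<open>j\<close> to \<open>n\<close> is
  \<open>diff l j + diff l n\<close>. Polarising \<open>form l\<close> contributes
  \<open>alt\<close>, and moving the base point from \<open>l\<close> to \<open>j\<close>
  contributes its square.\<close>

lemma rho_triangle:
  "rho j n = rho l j + rho l n + (alt (diff l j) (diff l n))\<^sup>2 + alt (diff l j) (diff l n)"
  by (cases l; cases j; cases n)
    (simp add: rho_simp alt_def diff_def square_add power_mult_distrib algebra_simps)

lemma inj_diff: "inj (diff l)"
  by (auto simp: inj_def diff_def prod_eq_iff)

lemma bij_diff: "bij (diff l)"
  using inj_diff finite_UNIV_inj_surj[of "diff l"] by (simp add: bij_def)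

lemma tr_rho: "tr (rho (x, y) (s, t)) = tr (x * y) + tr (s * t)"
proof -
  have "rho (x, y) (s, t) = (x * t + y * s)\<^sup>2 + (x * t + y * s) + (x * y + s * t)"
    by (simp add: rho_simp square_add power_mult_distrib algebra_simps)
  then show ?thesis
    by (simp add: tr_add)
qed

lemma one_add_eq_0_iff: "1 + tr x = 0 \<longleftrightarrow> tr x = 1"
  by (metis add_eq_0)

text \<open>This replaces membership in \<open>pts\<close> by a trace condition, so that counts can
  run over all displacements.\<close>

lemma pts_iff_tr_rho: "l \<in> pts \<Longrightarrow> j \<in> pts \<longleftrightarrow> tr (rho l j) = 0"
  by (cases l; cases j) (auto simp: pts_def tr_rho one_add_eq_0_iff)

lemma anisotropic:
  assumes "tr t = 1" "a\<^sup>2 + a * b + t * b\<^sup>2 = 0"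
  shows "a = 0 \<and> b = 0"
proof -
  have "b = 0"
  proof (rule ccontr)
    assume b: "b \<noteq> 0"
    have "t * b\<^sup>2 = a\<^sup>2 + a * b"
      using assms(2) add_eq_0 by metis
    then have "t = (a / b)\<^sup>2 + a / b"
      using b by (simp add: field_simps power2_eq_square)
    then show False
      using assms(1) by (simp add: tr_add)
  qed
  then show ?thesis
    using assms(2) by simp
qed

lemma tr_pts: "(x, y) \<in> pts \<Longrightarrow> tr (x\<^sup>2 * y\<^sup>2) = 1"
  by (simp add: pts_def power_mult_distrib[symmetric])

text \<open>Multiplied by \<open>x\<^sup>2\<close>, the form becomes the norm form with parameter
  \<open>x\<^sup>2 * y\<^sup>2\<close>, whose trace is 1.\<close>

lemma form_eq_0_iff:
  assumes "l \<in> pts"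
  shows "form l d = 0 \<longleftrightarrow> d = (0, 0)"
proof
  assume 0: "form l d = 0"
  obtain x y d1 d2 where ld: "l = (x, y)" "d = (d1, d2)"
    by fastforce
  have x: "x \<noteq> 0"
    using assms by (auto simp: ld pts_def)
  have "(x\<^sup>2 * d1)\<^sup>2 + (x\<^sup>2 * d1) * d2 + (x\<^sup>2 * y\<^sup>2) * d2\<^sup>2 = x\<^sup>2 * form l d"
    by (simp add: form_def ld power2_eq_square algebra_simps)
  then have "x\<^sup>2 * d1 = 0 \<and> d2 = 0"
    using anisotropic[OF tr_pts, of x y "x\<^sup>2 * d1" d2] 0 assms ld by simp
  then show "d = (0, 0)"
    using x ld by simp
qed (simp add: form_def split: prod.splits)

lemma rho_eq_0_iff:
  assumes "l \<in> pts"
  shows "rho l n = 0 \<longleftrightarrow> l = n"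
  using form_eq_0_iff[OF assms, of "diff l n"] rho_form[of l n] by (cases l; cases n) (auto simp: diff_def)

text \<open>Multiplicativity of the norm of the quadratic extension: up to scaling, the right side
  is the norm of the element of \<open>e\<close> times the conjugate of the element of
  \<open>d\<close>.\<close>

lemma form_composition:
  "form (x, y) (e1, e2) * form (x, y) (d1, d2) =
    (x\<^sup>2 * e1 * d1 + y\<^sup>2 * e2 * d2 + e1 * d2)\<^sup>2
    + (x\<^sup>2 * e1 * d1 + y\<^sup>2 * e2 * d2 + e1 * d2) * (d1 * e2 + d2 * e1)
    + x\<^sup>2 * y\<^sup>2 * (d1 * e2 + d2 * e1)\<^sup>2"
  by (simp add: form_def square_add power_mult_distrib algebra_simps power2_eq_square)

text \<open>Both \<open>x\<^sup>2 * y\<^sup>2\<close> and 1 have trace 1, so they differ by some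
  \<open>t\<^sup>2 + t\<close>. Shifting the first coordinate of the composition law by
  \<open>t * w\<close> then normalises the coefficient of \<open>w\<^sup>2\<close> to 1, removing
  the dependence on \<open>l\<close>.\<close>

lemma form_coordinates:
  assumes "l \<in> pts" "e \<noteq> (0, 0)"
  obtains h where "bij h"
    and "\<And>d w g. h d = (w, g) \<Longrightarrow> w = alt d e \<and> form l e * form l d = g\<^sup>2 + g * w + w\<^sup>2"
proof -
  obtain x y e1 e2 where le: "l = (x, y)" "e = (e1, e2)"
    by fastforce
  have "tr (x\<^sup>2 * y\<^sup>2 + 1) = 0"
    using assms le by (simp add: tr_add tr_pts)
  then obtain t where t: "t\<^sup>2 + t = x\<^sup>2 * y\<^sup>2 + 1"
    using tr_eq_0_imp by blast
  then have t': "x\<^sup>2 * y\<^sup>2 = t\<^sup>2 + t + 1"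
    by (simp add: add.assoc)
  define h where "h d = (alt d e,
    x\<^sup>2 * e1 * fst d + y\<^sup>2 * e2 * snd d + e1 * snd d + t * alt d e)" for d
  have norm: "form l e * form l d = g\<^sup>2 + g * w + w\<^sup>2" if "h d = (w, g)" for d w g
  proof -
    obtain d1 d2 where d: "d = (d1, d2)"
      by fastforce
    define G where "G = x\<^sup>2 * e1 * d1 + y\<^sup>2 * e2 * d2 + e1 * d2"
    have wg: "w = d1 * e2 + d2 * e1" "g = G + t * w"
      using that by (auto simp: h_def alt_def le d G_def)
    have "form l e * form l d = G\<^sup>2 + G * w + (t\<^sup>2 + t + 1) * w\<^sup>2"
      using form_composition[of x y e1 e2 d1 d2] t' by (simp only: le d G_def wg)
    also have "\<dots> = g\<^sup>2 + g * w + w\<^sup>2"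
      by (simp add: wg(2) square_add power_mult_distrib algebra_simps power2_eq_square)
    finally show ?thesis .
  qed
  have add: "h (a + b) = h a + h b" for a b
    by (simp add: h_def alt_def algebra_simps)
  have "a = b" if "h a = h b" for a b
  proof -
    have "h (a + b) = (0, 0)"
      using that by (simp add: add prod_eq_iff)
    then have "form l e * form l (a + b) = 0"
      using norm by fastforce
    then have "a + b = (0, 0)"
      using form_eq_0_iff assms by simp
    then show "a = b"
      by (simp add: prod_eq_iff)
  qed
  then have "inj h"
    by (rule injI)
  then have "bij h"
    using finite_UNIV_inj_surj[of h] by (simp add: bij_def)
  then show ?thesis
    using that[of h] norm by (simp add: h_def)
qed

section \<open>Counting triangles with prescribed sides\<close>

lemma card_bij_vimage: "bij h \<Longrightarrow> card {x. P (h x)} = card {y. P y}"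
  using card_vimage_inj[of h "{y. P y}"] by (simp add: bij_def vimage_def)

text \<open>Substitute \<open>(w, g)\<close> for \<open>j\<close> through
  \<open>form_coordinates\<close> with \<open>e = diff l n\<close>; \<open>rho_triangle\<close>
  supplies the third side. The right side involves \<open>l\<close> and \<open>n\<close> only
  through \<open>rho l n\<close>, which is the source of regularity.\<close>

lemma card_triangles:
  assumes "l \<in> pts" "n \<in> pts" "l \<noteq> n"
  shows "card {j \<in> pts. P (rho l j) (rho j n)} = card {(w, g).
    tr ((g\<^sup>2 + g * w + w\<^sup>2) / rho l n) = 0 \<and>
    P ((g\<^sup>2 + g * w + w\<^sup>2) / rho l n) ((g\<^sup>2 + g * w + w\<^sup>2) / rho l n + rho l n + w\<^sup>2 + w)}"
    (is "_ = card {(w, g). ?Q w g}")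
proof -
  have "diff l n \<noteq> (0, 0)"
    using assms(3) by (auto simp: diff_def prod_eq_iff)
  then obtain h where h: "bij h"
    and norm: "\<And>d w g. h d = (w, g) \<Longrightarrow>
      w = alt d (diff l n) \<and> form l (diff l n) * form l d = g\<^sup>2 + g * w + w\<^sup>2"
    using form_coordinates[OF assms(1)] by metis
  have b: "rho l n \<noteq> 0"
    using rho_eq_0_iff assms by blast
  have "j \<in> pts \<and> P (rho l j) (rho j n) \<longleftrightarrow> (case h (diff l j) of (w, g) \<Rightarrow> ?Q w g)" for j
  proof -
    obtain w g where wg: "h (diff l j) = (w, g)"
      by fastforce
    have "rho l n * rho l j = g\<^sup>2 + g * w + w\<^sup>2"
      using norm[OF wg] by (simp add: rho_form)
    then have 1: "(g\<^sup>2 + g * w + w\<^sup>2) / rho l n = rho l j"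
      using b by (simp add: field_simps)
    have 2: "rho j n = rho l j + rho l n + w\<^sup>2 + w"
      using rho_triangle[of j n l] norm[OF wg] by simp
    show ?thesis
      unfolding wg prod.case 1 using pts_iff_tr_rho[OF assms(1)] 2 by simp
  qed
  then have "{j \<in> pts. P (rho l j) (rho j n)} = {j. case (h \<circ> diff l) j of (w, g) \<Rightarrow> ?Q w g}"
    by auto
  then show ?thesis
    using card_bij_vimage[OF bij_comp[OF bij_diff h], of "\<lambda>(w, g). ?Q w g" l] by simp
qed

text \<open>Scaling \<open>d\<close> by \<open>t\<close> multiplies the form by
  \<open>t\<^sup>2\<close>, and every element is a square, so all nonzero values are taken equally
  often. With \<open>q = 2 ^ m\<close>, the \<open>q\<^sup>2 - 1\<close> nonzero displacements are
  shared among \<open>q - 1\<close> values.\<close>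

lemma card_form:
  assumes "l \<in> pts" "c \<noteq> 0"
  shows "card {d. form l d = c} = 2 ^ m + 1"
proof -
  have scale: "form l (t * fst d, t * snd d) = t\<^sup>2 * form l d" for t d
    by (cases l; cases d) (simp add: form_def power_mult_distrib algebra_simps power2_eq_square)
  have eq: "card {d. form l d = a} = card {d. form l d = c}" if a: "a \<noteq> 0" for a
  proof -
    obtain t where t: "a / c = t\<^sup>2"
      using square_surj by blast
    then have t0: "t \<noteq> 0"
      using a assms(2) by auto
    have at: "a = t\<^sup>2 * c"
      using t assms(2) by (simp add: field_simps)
    let ?h = "\<lambda>d. (t * fst d, t * snd d)"
    have "bij ?h"
      using t0 by (intro o_bij[of "\<lambda>d. (fst d / t, snd d / t)"]) auto
    moreover have "form l (?h d) = a \<longleftrightarrow> form l d = c" for d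
      using t0 by (simp add: at scale)
    ultimately show ?thesis
      using card_bij_vimage[of ?h "\<lambda>d. form l d = a"] by simp
  qed
  have "2 ^ m * 2 ^ m = card (UNIV :: ('a \<times> 'a) set)"
    by (simp add: card_field card_cartesian_product flip: UNIV_Times_UNIV)
  also have "\<dots> = card (\<Union>a\<in>UNIV. {d. form l d = a})"
    by (rule arg_cong[where f = card]) auto
  also have "\<dots> = (\<Sum>a\<in>UNIV. card {d. form l d = a})"
    by (rule card_UN_disjoint) auto
  also have "\<dots> = card {d. form l d = 0} + (\<Sum>a\<in>UNIV - {0}. card {d. form l d = a})"
    by (rule sum.remove) auto
  also have "\<dots> = 1 + (2 ^ m - 1) * card {d. form l d = c}"
    using eq by (simp add: form_eq_0_iff[OF assms(1)] card_Diff_singleton card_field)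
  finally have "2 ^ m * 2 ^ m = 1 + (2 ^ m - 1) * card {d. form l d = c}" .
  then have "(2 ^ m - 1) * (int (card {d. form l d = c}) - (2 ^ m + 1)) = 0"
    by (simp add: algebra_simps of_nat_diff flip: of_nat_eq_iff[where 'a = int])
  moreover have "(2::int) ^ m \<noteq> 1"
    using odd_pos[OF odd_degree] by (simp add: power_eq_1_iff)
  ultimately have "int (card {d. form l d = c}) = int (2 ^ m + 1)"
    by simp
  then show ?thesis
    by (simp only: of_nat_eq_iff)
qed

lemma card_neighbours:
  assumes "l \<in> pts" "c \<noteq> 0" "tr c = 0"
  shows "card {j \<in> pts. rho l j = c} = 2 ^ m + 1"
proof -
  have "{j \<in> pts. rho l j = c} = {j. form l (diff l j) = c}"
    using assms pts_iff_tr_rho[OF assms(1)] by (auto simp: rho_form)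
  then show ?thesis
    using card_bij_vimage[OF bij_diff, of "\<lambda>d. form l d = c"] card_form assms by simp
qed

text \<open>This is pseudocyclicity. Equality of the two sides means
  \<open>w\<^sup>2 + w = b\<close>, which has two solutions, and for each of them the trace
  condition holds for half of all \<open>g\<close>.\<close>

lemma card_isosceles:
  assumes "l \<in> pts" "n \<in> pts" "l \<noteq> n"
  shows "card {j \<in> pts. rho l j = rho j n} = 2 ^ m"
proof -
  define b where "b = rho l n"
  have b: "b \<noteq> 0" "tr b = 0"
    using assms rho_eq_0_iff[of l n] pts_iff_tr_rho[of l n] by (auto simp: b_def)
  let ?G = "\<lambda>w. {g. tr ((g\<^sup>2 + g * w + w\<^sup>2) / b) = 0}"
  have G: "card (?G w) = card {x. tr x = 0}" if w: "w\<^sup>2 + w = b" for w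
  proof -
    have w0: "w \<noteq> 0"
      using w b by auto
    define h where "h g = g\<^sup>2 * w / b\<^sup>2 + w\<^sup>2 / b" for g
    have "inj h"
      using w0 b by (auto simp: inj_def h_def square_inj)
    then have "bij h"
      using finite_UNIV_inj_surj[of h] by (simp add: bij_def)
    moreover have "tr ((g\<^sup>2 + g * w + w\<^sup>2) / b) = tr (h g)" for g
    proof -
      \<comment> \<open>Squaring the mixed term inside the trace makes the argument affine in
        \<open>g\<^sup>2\<close>.\<close>
      have "tr ((g\<^sup>2 + g * w + w\<^sup>2) / b) = tr (g\<^sup>2 / b) + tr ((g * w / b)\<^sup>2) + tr (w\<^sup>2 / b)"
        by (simp add: add_divide_distrib tr_add)
      also have "\<dots> = tr (g\<^sup>2 / b + (g * w / b)\<^sup>2 + w\<^sup>2 / b)"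
        by (simp only: tr_add)
      also have "g\<^sup>2 / b + (g * w / b)\<^sup>2 = g\<^sup>2 * (b + w\<^sup>2) / b\<^sup>2"
        using b by (simp add: field_simps power2_eq_square)
      also have "b + w\<^sup>2 = w"
        by (simp add: w[symmetric] add_ac)
      finally show ?thesis
        by (simp add: h_def)
    qed
    ultimately show ?thesis
      using card_bij_vimage[of h "\<lambda>x. tr x = 0"] by simp
  qed
  have "a = a + b + w\<^sup>2 + w \<longleftrightarrow> w\<^sup>2 + w = b" for a w :: 'a
  proof -
    have "a + b + w\<^sup>2 + w = a + ((w\<^sup>2 + w) + b)"
      by (simp only: add_ac)
    then show ?thesis
      by (simp only: add_cancel_right_right add_eq_0)
  qed
  then have "card {j \<in> pts. rho l j = rho j n} = card (SIGMA w:{w. w\<^sup>2 + w = b}. ?G w)"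
    using card_triangles[OF assms, of "(=)"] by (auto simp: b_def[symmetric] Sigma_def intro!: arg_cong[where f = card])
  also have "\<dots> = (\<Sum>w\<in>{w. w\<^sup>2 + w = b}. card (?G w))"
    by (simp add: card_SigmaI)
  also have "\<dots> = card {w. w\<^sup>2 + w = b} * card {x. tr x = 0}"
    using G by simp
  finally show ?thesis
    using card_square_add_self[OF b(2)] card_tr_fiber by simp
qed

text \<open>Off the diagonal \<open>card_triangles\<close> depends only on \<open>rho l n\<close>;
  on the diagonal the count is a valency or 0.\<close>

lemma card_triangle_regular:
  assumes "tr a = 0" "l \<in> pts" "n \<in> pts" "l' \<in> pts" "n' \<in> pts" "rho l n = rho l' n'"
  shows "card {j \<in> pts. rho l j = a \<and> rho j n = b} = card {j \<in> pts. rho l' j = a \<and> rho j n' = b}"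
proof (cases "l = n")
  case False
  then have "l' \<noteq> n'"
    using assms rho_eq_0_iff by metis
  then show ?thesis
    using False assms card_triangles[of _ _ "\<lambda>c d. c = a \<and> d = b"] by simp
next
  case True
  then have "l' = n'"
    using assms rho_eq_0_iff by metis
  have count: "card {j \<in> pts. rho h j = a \<and> rho j h = b}
    = (if a = b then if a = 0 then 1 else 2 ^ m + 1 else 0)" if h: "h \<in> pts" for h
  proof -
    have "{j \<in> pts. rho h j = a \<and> rho j h = b} = (if a = b then {j \<in> pts. rho h j = a} else {})"
      using rho_sym[of h] by auto
    moreover have "{j \<in> pts. rho h j = 0} = {h}"
      using h rho_eq_0_iff by auto
    ultimately show ?thesis
      using card_neighbours[OF h, of a] assms(1) by auto
  qed
  show ?thesis
    using count[OF assms(2)] count[OF assms(4)] True \<open>l' = n'\<close> by simp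
qed

lemma sum_twisted_triangles:
  assumes "coprime k m" "l \<in> pts" "n \<in> pts" "l \<noteq> n"
  shows "(\<Sum>c\<in>{c. tr c = 0} - {0}. card {j \<in> pts. rho l j = c \<and> rho j n = c ^ 2 ^ k}) = 2 ^ m + 1"
proof -
  let ?K = "{c. tr c = 0}" and ?frob = "\<lambda>c :: 'a. c ^ 2 ^ k"
  have frob: "bij ?frob"
    using finite_UNIV_inj_surj[of ?frob] by (simp add: bij_def inj_def frob_inj)
  interpret scheme_automorphism pts rho ?K 0 "2 ^ m + 1" ?frob "map_prod ?frob ?frob"
  proof unfold_locales
    show "rho l n \<in> ?K" if "l \<in> pts" "n \<in> pts" for l n
      using that pts_iff_tr_rho by blast
    show "rho l n = rho n l" for l n
      by (rule rho_sym)
    show "rho l n = 0 \<longleftrightarrow> l = n" if "l \<in> pts" "n \<in> pts" for l n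
      using that rho_eq_0_iff by blast
    show "card {j \<in> pts. rho l j = c} = 2 ^ m + 1" if "l \<in> pts" "c \<in> ?K - {0}" for l c
      using that card_neighbours by auto
    show "card {j \<in> pts. rho l j = a \<and> rho j n = b} = card {j \<in> pts. rho l' j = a \<and> rho j n' = b}"
      if "a \<in> ?K" "b \<in> ?K" "l \<in> pts" "n \<in> pts" "l' \<in> pts" "n' \<in> pts" "rho l n = rho l' n'"
      for a b l n l' n'
      using that by (intro card_triangle_regular) auto
    have inj: "inj_on (map_prod ?frob ?frob) pts"
      by (auto simp: inj_on_def frob_inj)
    have "map_prod ?frob ?frob ` pts \<subseteq> pts"
      by (auto simp: pts_def tr_frob simp flip: power_mult_distrib)
    then show "bij_betw (map_prod ?frob ?frob) pts pts"
      using inj endo_inj_surj[of pts "map_prod ?frob ?frob"] by (simp add: bij_betw_def)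
    show "bij_betw ?frob ?K ?K"
      unfolding bij_betw_def
    proof
      show inj: "inj_on ?frob ?K"
        by (simp add: inj_on_def frob_inj)
      show "?frob ` ?K = ?K"
        by (rule endo_inj_surj[OF _ _ inj]) (auto simp: tr_frob)
    qed
    \<comment> \<open>\<open>rho\<close> is a polynomial over the prime field, so it commutes with
      the Frobenius power; this identity aligns the exponents.\<close>
    have "(c ^ 2 ^ k)\<^sup>2 = (c\<^sup>2) ^ 2 ^ k" for c :: 'a
      by (metis power_mult mult.commute)
    then show "rho (map_prod ?frob ?frob l) (map_prod ?frob ?frob n) = ?frob (rho l n)" for l n
      by (cases l; cases n) (simp add: rho_simp frob_add power_mult_distrib)
    show "?frob c = c \<longleftrightarrow> c = 0" if "c \<in> ?K" for c
      using that frob_fixed[OF assms(1)] by auto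
    show "(\<Sum>c\<in>?K - {0}. card {j \<in> pts. rho l j = c \<and> rho j n = c}) = 2 ^ m + 1 - 1"
      if "l \<in> pts" "n \<in> pts" "l \<noteq> n" for l n
    proof -
      \<comment> \<open>The colour 0 cannot occur, since it would force \<open>l = j = n\<close>.
        The sum therefore counts all isosceles \<open>j\<close>.\<close>
      have "rho l j \<in> ?K - {0}" if j: "j \<in> pts" "rho l j = rho j n" for j
        using j pts_iff_tr_rho[of l j] rho_eq_0_iff[of l j] rho_eq_0_iff[of j n]
          \<open>l \<in> pts\<close> \<open>l \<noteq> n\<close> by auto
      then have eq: "(\<Union>c\<in>?K - {0}. {j \<in> pts. rho l j = c \<and> rho j n = c}) = {j \<in> pts. rho l j = rho j n}"
        by auto
      have "(\<Sum>c\<in>?K - {0}. card {j \<in> pts. rho l j = c \<and> rho j n = c})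
        = card (\<Union>c\<in>?K - {0}. {j \<in> pts. rho l j = c \<and> rho j n = c})"
        by (rule card_UN_disjoint[symmetric]) auto
      then show ?thesis
        unfolding eq using card_isosceles that by simp
    qed
  qed simp_all
  show ?thesis
    using sum_twisted_intersection_numbers assms by blast
qed

end

section \<open>Exterior lines\<close>

lemma mem_perp: "a \<in> perp v \<longleftrightarrow> a $ 1 * v $ 1 + a $ 2 * v $ 2 + a $ 3 * v $ 3 = 0"
  by (simp add: perp_def sum_3)

lemma subspace_perp: "vec.subspace (perp v)"
proof -
  have "a + b \<in> perp v" if "a \<in> perp v" "b \<in> perp v" for a b
  proof -
    have "(a + b) $ 1 * v $ 1 + (a + b) $ 2 * v $ 2 + (a + b) $ 3 * v $ 3
      = (a $ 1 * v $ 1 + a $ 2 * v $ 2 + a $ 3 * v $ 3) + (b $ 1 * v $ 1 + b $ 2 * v $ 2 + b $ 3 * v $ 3)"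
      by (simp add: algebra_simps)
    then show ?thesis
      using that by (simp add: mem_perp)
  qed
  moreover have "c *s a \<in> perp v" if "a \<in> perp v" for a c
  proof -
    have "(c *s a) $ 1 * v $ 1 + (c *s a) $ 2 * v $ 2 + (c *s a) $ 3 * v $ 3
      = c * (a $ 1 * v $ 1 + a $ 2 * v $ 2 + a $ 3 * v $ 3)"
      by (simp add: algebra_simps)
    then show ?thesis
      using that by (simp add: mem_perp)
  qed
  ultimately show ?thesis
    by (simp add: vec.subspace_def mem_perp[of 0])
qed

lemma perp_scale:
  fixes v :: "'a::{field,finite} ^ 3"
  assumes "c \<noteq> 0"
  shows "perp (c *s v) = perp v"
proof -
  have "a $ 1 * (c *s v) $ 1 + a $ 2 * (c *s v) $ 2 + a $ 3 * (c *s v) $ 3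
    = c * (a $ 1 * v $ 1 + a $ 2 * v $ 2 + a $ 3 * v $ 3)" for a :: "'a ^ 3"
    by (simp add: algebra_simps)
  with assms show ?thesis
    by (simp add: set_eq_iff mem_perp)
qed

lemma perp_vector_1_inject:
  fixes x :: "'a::{field,finite}"
  shows "perp (vector [1, x, y]) = perp (vector [1, z, u]) \<longleftrightarrow> x = z \<and> y = u"
proof
  assume eq: "perp (vector [1, x, y]) = perp (vector [1, z, u])"
  have "vector [- x, 1, 0] \<in> perp (vector [1, x, y])" "vector [- y, 0, 1] \<in> perp (vector [1, x, y])"
    by (simp_all add: mem_perp)
  then show "x = z \<and> y = u"
    unfolding eq by (simp add: mem_perp)
qed simp

lemma pg_lines_perp: 
  fixes x :: "'a::{field,finite}"
  shows "perp (vector [1, x, y]) \<in> pg_lines"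
proof -
  let ?L = "perp (vector [1, x, y])" and ?u = "vector [- x, 1, 0] :: 'a ^ 3" and ?v = "vector [- y, 0, 1] :: 'a ^ 3"
  have sub: "{?u, ?v} \<subseteq> ?L"
    by (simp add: mem_perp)
  have "?u \<noteq> c *s ?v" for c
    by (auto simp: vec_eq_iff forall_3)
  then have "vec.independent {?u, ?v}"
    by (intro vec.independent_insertI) (auto simp: vec.span_singleton vec.independent_empty vec_eq_iff forall_3)
  moreover have "?L \<subseteq> vec.span {?u, ?v}"
  proof
    fix a assume "a \<in> ?L"
    then have "a $ 1 + (a $ 2 * x + a $ 3 * y) = 0"
      by (simp add: mem_perp add.assoc)
    then have "a $ 1 = - (a $ 2 * x + a $ 3 * y)"
      by (simp only: eq_neg_iff_add_eq_0)
    then have "a = a $ 2 *s ?u + a $ 3 *s ?v"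
      by (simp add: vec_eq_iff forall_3)
    also have "\<dots> \<in> vec.span {?u, ?v}"
      by (intro vec.span_add vec.span_scale vec.span_base) auto
    finally show "a \<in> vec.span {?u, ?v}" .
  qed
  moreover have "?u \<noteq> ?v"
    by (simp add: vec_eq_iff forall_3)
  ultimately have "vec.dim ?L = 2"
    using sub by (intro vec.dim_unique[of "{?u, ?v}"]) auto
  then show ?thesis
    by (simp add: pg_lines_def subspace_perp)
qed

lemma pg_lines_obtain_perp:
  fixes L :: "('a::{field,finite} ^ 3) set"
  assumes "L \<in> pg_lines"
  obtains v where "v \<noteq> 0" "L = perp v"
proof -
  have L: "vec.subspace L" "vec.dim L = 2"
    using assms by (auto simp: pg_lines_def)
  obtain S where S: "S \<subseteq> L" "vec.independent S" "L \<subseteq> vec.span S" "card S = 2"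
    using vec.basis_exists[of L] L(2) by metis
  then obtain a b where ab: "S = {a, b}"
    by (auto simp: card_2_iff)
  \<comment> \<open>A basis of \<open>L\<close> padded by a zero row gives a singular matrix, and a
    nonzero kernel vector is orthogonal to all of \<open>L\<close>.\<close>
  let ?A = "vector [a, b, 0] :: 'a ^ 3 ^ 3"
  have "\<not> surj (\<lambda>x. ?A *v x)"
  proof
    assume "surj (\<lambda>x. ?A *v x)"
    then obtain x where "vector [0, 0, 1] = ?A *v x"
      by (metis surjD)
    then have "(vector [0, 0, 1] :: 'a ^ 3) $ 3 = (?A *v x) $ 3"
      by simp
    then show False
      by (simp add: matrix_vector_mult_def)
  qed
  then have "\<not> (\<exists>B. ?A ** B = mat 1)"
    by (simp add: matrix_right_invertible_surjective)
  then have "\<not> (\<exists>B. B ** ?A = mat 1)"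
    by (metis matrix_left_right_inverse)
  then obtain v where v: "v \<noteq> 0" "?A *v v = 0"
    using matrix_left_invertible_ker by blast
  have "(?A *v v) $ 1 = 0" "(?A *v v) $ 2 = 0"
    using v by simp_all
  then have "S \<subseteq> perp v"
    by (simp add: ab mem_perp matrix_vector_mult_def sum_3)
  then have sub: "L \<subseteq> perp v"
    using S(3) vec.span_minimal subspace_perp by blast
  obtain i where i: "v $ i \<noteq> 0"
    using v(1) by (auto simp: vec_eq_iff)
  \<comment> \<open>A unit vector outside \<open>perp v\<close> bounds its dimension by 2, so the
    inclusion of \<open>L\<close> is an equality.\<close>
  have "axis i 1 \<notin> perp v"
    using i exhaust_3[of i] by (auto simp: mem_perp axis_def)
  then have "perp v \<noteq> UNIV"
    by blast
  then have "\<not> vec.dim (UNIV :: ('a ^ 3) set) \<le> vec.dim (perp v)"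
    using vec.subspace_dim_equal[OF subspace_perp vec.subspace_UNIV subset_UNIV] by blast
  then have "vec.dim (perp v) \<noteq> 3"
    unfolding vec_dim_card by simp
  moreover have "vec.dim (perp v) \<le> 3"
    using dim_subset_UNIV_cart_gen[of "perp v"] by simp
  ultimately have "L = perp v"
    using L sub subspace_perp by (intro vec.subspace_dim_equal) auto
  then show ?thesis
    using that v(1) by blast
qed

context odd_binary_field
begin

section \<open>Lines and the conic\<close>

lemma span_subset_perp: "vec.span {w} \<subseteq> perp v \<longleftrightarrow> w \<in> perp v"
  using subspace_perp[of v] vec.span_minimal vec.span_base by (metis empty_subsetI insert_subset singletonI subsetD)

lemma meets_conic_iff:
  "(\<exists>P\<in>conic. P \<subseteq> perp v) \<longleftrightarrow> v $ 2 = 0 \<or> (\<exists>s. s * v $ 1 + s\<^sup>2 * v $ 2 + v $ 3 = (0::'a))"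
proof -
  have "(\<exists>P\<in>conic. P \<subseteq> perp v) \<longleftrightarrow>
    (\<exists>s. vec.span {vector [s, s\<^sup>2, 1]} \<subseteq> perp v) \<or> vec.span {vector [0, 1, 0]} \<subseteq> perp v"
    unfolding conic_def by blast
  then show ?thesis
    by (auto simp: span_subset_perp mem_perp)
qed

text \<open>If \<open>x = 0\<close>, the line contains the point spanned by
  \<open>(0, 1, 0)\<close>. Otherwise \<open>t = s * x\<close> turns the incidence equation into
  \<open>t\<^sup>2 + t = x * y\<close>.\<close>

lemma meets_conic_vector_1_iff:
  "(\<exists>P\<in>conic. P \<subseteq> perp (vector [1, x, y])) \<longleftrightarrow> tr (x * y) = 0"
proof (cases "x = 0")
  case True
  then show ?thesis
    using meets_conic_iff[of "vector [1, x, y]"] by simp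
next
  case False
  have "(\<exists>s. s + s\<^sup>2 * x + y = 0) \<longleftrightarrow> tr (x * y) = 0"
  proof
    assume "\<exists>s. s + s\<^sup>2 * x + y = 0"
    then obtain s where "y = s + s\<^sup>2 * x"
      using add_eq_0 by metis
    then have "x * y = (s * x)\<^sup>2 + s * x"
      by (simp add: algebra_simps power2_eq_square)
    then show "tr (x * y) = 0"
      by (simp add: tr_add)
  next
    assume "tr (x * y) = 0"
    then obtain t where t: "t\<^sup>2 + t = x * y"
      using tr_eq_0_imp by blast
    have "x * (t / x + (t / x)\<^sup>2 * x + y) = (t\<^sup>2 + t) + x * y"
      using False by (simp add: field_simps power2_eq_square)
    then show "\<exists>s. s + s\<^sup>2 * x + y = 0"
      using t False by (metis add_self mult_eq_0_iff)
  qed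
  then show ?thesis
    using False meets_conic_iff[of "vector [1, x, y]"] by simp
qed

definition line :: "'a \<times> 'a \<Rightarrow> ('a ^ 3) set" where
  "line p = perp (vector [1, fst p, snd p])"

lemma inj_line: "inj line"
  by (auto simp: inj_def line_def perp_vector_1_inject prod_eq_iff)

lemma exterior_lines_eq: "exterior_lines = line ` pts"
proof (intro equalityI subsetI)
  fix L :: "('a ^ 3) set" assume L: "L \<in> exterior_lines"
  then obtain v where v: "v \<noteq> 0" "L = perp v"
    using pg_lines_obtain_perp by (auto simp: exterior_lines_def)
  have ext: "\<not> (\<exists>P\<in>conic. P \<subseteq> perp v)"
    using L v by (auto simp: exterior_lines_def)
  \<comment> \<open>Otherwise the incidence equation would reduce to prescribing
    \<open>s\<^sup>2\<close>, which is solvable as squaring is onto.\<close>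
  have "v $ 1 \<noteq> 0"
  proof
    assume v1: "v $ 1 = 0"
    have v2: "v $ 2 \<noteq> 0"
      using ext meets_conic_iff by blast
    obtain s where "v $ 3 / v $ 2 = s\<^sup>2"
      using square_surj by blast
    then have "s * v $ 1 + s\<^sup>2 * v $ 2 + v $ 3 = 0"
      using v1 v2 by (simp add: field_simps)
    then show False
      using ext meets_conic_iff by blast
  qed
  then have "L = line (v $ 2 / v $ 1, v $ 3 / v $ 1)"
  proof -
    assume "v $ 1 \<noteq> 0"
    then have "v = v $ 1 *s vector [1, v $ 2 / v $ 1, v $ 3 / v $ 1]"
      by (simp add: vec_eq_iff forall_3)
    then show ?thesis
      using v perp_scale \<open>v $ 1 \<noteq> 0\<close> by (metis fst_conv line_def snd_conv)
  qed
  moreover from this have "(v $ 2 / v $ 1, v $ 3 / v $ 1) \<in> pts"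
    using ext v meets_conic_vector_1_iff tr_cases[of "v $ 2 / v $ 1 * (v $ 3 / v $ 1)"]
    by (auto simp: line_def pts_def)
  ultimately show "L \<in> line ` pts"
    by blast
next
  fix L assume "L \<in> line ` pts"
  then obtain x y where L: "L = perp (vector [1, x, y])" and "tr (x * y) = 1"
    by (auto simp: line_def pts_def)
  then have "\<not> (\<exists>P\<in>conic. P \<subseteq> L)"
    using meets_conic_vector_1_iff[of x y] by simp
  then show "L \<in> exterior_lines"
    using pg_lines_perp L by (simp add: exterior_lines_def)
qed

section \<open>Transfer to the elliptic scheme\<close>

lemma rho_hat_line: "rho_hat (line l) (line n) = rho l n"
  unfolding rho_hat_def line_def perp_vector_1_inject by (rule the_equality) (auto simp: rho_def split: prod.splits)

text \<open>The case \<open>a = 0\<close> needs no exception, since \<open>rho\<close> vanishes on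
  \<open>pts\<close> exactly on the diagonal.\<close>

lemma elliptic_rel_line:
  assumes "l \<in> pts" "n \<in> pts"
  shows "(line l, line n) \<in> elliptic_rel a \<longleftrightarrow> rho l n = a"
  using assms rho_eq_0_iff[OF assms(1), of n]
  by (auto simp: elliptic_rel_def exterior_lines_eq rho_hat_line inj_eq[OF inj_line])

lemma elliptic_rel_cases:
  assumes "(L, N) \<in> elliptic_rel a"
  obtains l n where "l \<in> pts" "n \<in> pts" "L = line l" "N = line n" "rho l n = a"
proof -
  have "L \<in> exterior_lines" "N \<in> exterior_lines"
    using assms by (auto simp: elliptic_rel_def split: if_splits)
  then obtain l n where "l \<in> pts" "n \<in> pts" "L = line l" "N = line n"
    by (auto simp: exterior_lines_eq)
  then show ?thesis
    using that assms elliptic_rel_line by blast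
qed

text \<open>Regularity makes the image under \<open>the_elem\<close> a singleton, and the pair of
  \<open>l\<close> and \<open>n\<close> shows that it is not empty.\<close>

lemma intersection_number_eq:
  assumes "l \<in> pts" "n \<in> pts" "tr a = 0"
  shows "intersection_number a b (rho l n) = card {j \<in> pts. rho l j = a \<and> rho j n = b}"
proof -
  let ?N = "\<lambda>(L, M). card {j \<in> exterior_lines. (L, j) \<in> elliptic_rel a \<and> (j, M) \<in> elliptic_rel b}"
  have N: "?N (line g, line h) = card {j \<in> pts. rho g j = a \<and> rho j h = b}" if "g \<in> pts" "h \<in> pts" for g h
  proof -
    have "{j \<in> exterior_lines. (line g, j) \<in> elliptic_rel a \<and> (j, line h) \<in> elliptic_rel b}
      = line ` {j \<in> pts. rho g j = a \<and> rho j h = b}"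
      using that by (auto simp: exterior_lines_eq elliptic_rel_line)
    then show ?thesis
      using inj_line by (simp add: card_image inj_on_subset)
  qed
  have "?N ` elliptic_rel (rho l n) = {card {j \<in> pts. rho l j = a \<and> rho j n = b}}"
  proof (intro equalityI subsetI)
    fix c assume "c \<in> ?N ` elliptic_rel (rho l n)"
    then obtain L M where LM: "(L, M) \<in> elliptic_rel (rho l n)" "c = ?N (L, M)"
      by auto
    then obtain g h where gh: "g \<in> pts" "h \<in> pts" "L = line g" "M = line h" "rho g h = rho l n"
      by (auto elim: elliptic_rel_cases)
    then have "c = card {j \<in> pts. rho g j = a \<and> rho j h = b}"
      using LM N by simp
    then show "c \<in> {card {j \<in> pts. rho l j = a \<and> rho j n = b}}"
      using card_triangle_regular[OF assms(3) gh(1,2) assms(1,2) gh(5)] by simp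
  next
    fix c assume "c \<in> {card {j \<in> pts. rho l j = a \<and> rho j n = b}}"
    then have "c = ?N (line l, line n)"
      using N assms by simp
    moreover have "(line l, line n) \<in> elliptic_rel (rho l n)"
      using assms elliptic_rel_line by blast
    ultimately show "c \<in> ?N ` elliptic_rel (rho l n)"
      by blast
  qed
  then show ?thesis
    by (simp add: intersection_number_def)
qed

lemma rho_attained:
  assumes "tr b = 0" "b \<noteq> 0"
  obtains l n where "l \<in> pts" "n \<in> pts" "rho l n = b"
proof -
  \<comment> \<open>A base point exists because \<open>tr 1 = 1\<close>; its valency in colour
    \<open>b\<close> is positive.\<close>
  have 1: "(1, 1) \<in> pts"
    by (simp add: pts_def)
  then have "card {j \<in> pts. rho (1, 1) j = b} \<noteq> 0"
    using card_neighbours assms by simp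
  then have "{j \<in> pts. rho (1, 1) j = b} \<noteq> {}"
    by (metis card.empty)
  then show ?thesis
    using that 1 by blast
qed

end

theorem theorem5:
  fixes m k q \<sigma> :: nat and b :: "'a::{field,finite}"
  assumes "odd m" and "q = 2 ^ m" and "CARD('a) = q"
    and "k \<in> {1..m - 1}" and "gcd k m = 1" and "\<sigma> = 2 ^ k"
    and "b \<in> trace_fiber m 0 - {0}"
  shows "(\<Sum>c \<in> trace_fiber m (0::'a) - {0}. intersection_number c (c ^ \<sigma>) b) = q + 1"
proof -
  interpret odd_binary_field m "abs_trace m :: 'a \<Rightarrow> 'a"
    using assms by unfold_locales auto
  have "abs_trace m b = 0" "b \<noteq> 0"
    using assms(7) by (auto simp: trace_fiber_def)
  \<comment> \<open>One fixed pair in relation \<open>b\<close> evaluates all the intersection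
    numbers in the sum.\<close>
  then obtain l n where ln: "l \<in> pts" "n \<in> pts" "rho l n = b"
    by (rule rho_attained)
  then have "l \<noteq> n"
    using rho_eq_0_iff[OF ln(1), of n] \<open>b \<noteq> 0\<close> by auto
  have "(\<Sum>c \<in> trace_fiber m 0 - {0}. intersection_number c (c ^ \<sigma>) b)
    = (\<Sum>c \<in> {c. abs_trace m c = 0} - {0}. card {j \<in> pts. rho l j = c \<and> rho j n = c ^ 2 ^ k})"
    using intersection_number_eq[OF ln(1,2)] assms(6) by (intro sum.cong) (auto simp: trace_fiber_def ln(3))
  also have "\<dots> = q + 1"
    using sum_twisted_triangles[OF _ ln(1,2) \<open>l \<noteq> n\<close>, of k] assms(2,5) by (simp add: coprime_iff_gcd_eq_1)
  finally show ?thesis .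
qed

end
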